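(* Let $\alpha,\beta$ be probability measures on $\mathbb{R}$ with all moments finite and with densities $A$ and $B$ respectively (with respect to Lebesgue measure), such that $\operatorname{supp}\beta\subseteq\operatorname{supp}\alpha$. Let $\{a_n\}_{n\ge 0}$ and $\{b_n\}_{n\ge 0}$ be the sequences of monic polynomials ($\deg a_n=\deg b_n=n$) orthogonal with respect to $\alpha$ and $\beta$ respectively, and put $\hat a_i=\int_{\mathbb{R}} a_i^2(x)A(x)\,dx$. Suppose that $B(x)/A(x)=W(x)$, where $$W(x)=1+\sum_{i=1}^{N} w_i\,\frac{a_i(x)}{\hat a_i},$$ the series converging in $L_2(\mathbb{R},\mathcal{B},\alpha)$; here $w_i$ are real numbers and $N$ is either a positive integer or infinite. Put $w_0=1$ and, if $N$ is finite, $w_i=0$ for $i\ge N+1$. Define recursively the numbers $\{f_n\}_{n\ge 0}$ by $f_0=1$ and $\sum_{i=0}^{n} f_{n-i}w_i=0$ for $n\ge 1$. (i) The monic polynomials $\phi_n(x)=\sum_{i=0}^{n} f_{n-i}a_i(x)$ satisfy $\int_{\mathbb{R}}\phi_n(x)B(x)\,dx=0$ for $n=1,2,\ldots$. Moreover, for all $n\ge 1$, $a_n(x)=\sum_{i=0}^{n} w_{n-i}\phi_i(x)$. (ii) If $N$ is finite, then $\int_{\mathbb{R}} a_i(x)B(x)\,dx=w_i$ for $i=1,\ldots,N$, and $\int_{\mathbb{R}} a_i(x)B(x)\,dx=0$ for all $i\ge N+1$. In particular, for $n\ge N+1$, $$a_n(x)=\phi_n(x)+\sum_{i=1}^{N}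 w_i\,\phi_{n-i}(x).$$ (iii) If $N$ is finite, then there exist $N$ sequences of numbers $\{\gamma_{n,j}\}_{n\ge 1}$, $1\le j\le N$, such that for all $n\ge 1$, $$a_n(x)=b_n(x)+\sum_{j=1}^{N}\gamma_{n,j}\,b_{n-j}(x),$$ where $b_m=0$ for $m<0$.
   Context: $\mathcal{B}$ denotes the Borel subsets of $\mathbb{R}$, and $L_2(\mathbb{R},\mathcal{B},\alpha)$ is the space of real functions square integrable with respect to $\alpha$. A polynomial of degree $n$ is monic if its coefficient at $x^n$ equals $1$. The sequence $\{a_n\}$ is orthogonal with respect to $\alpha$ if $\int a_n a_m\,d\alpha=\delta_{nm}\hat a_n$ for all $m,n\ge 0$, and similarly for $\{b_n\}$ and $\beta$. *)

theory Defs
  imports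
    "HOL-Probability.Probability"
    "HOL-Computational_Algebra.Polynomial"
begin

(* Nonnegativity is required explicitly because "ennreal" truncates negative reals to 0. *)
definition has_lebesgue_density :: "real measure \<Rightarrow> (real \<Rightarrow> real) \<Rightarrow> bool" where
  "has_lebesgue_density M D \<longleftrightarrow>
     D \<in> borel_measurable borel \<and> (\<forall>x. 0 \<le> D x) \<and> M = density lborel (\<lambda>x. ennreal (D x))"

definition finite_moments :: "real measure \<Rightarrow> bool" where
  "finite_moments M \<longleftrightarrow> (\<forall>n. integrable M (\<lambda>x. x ^ n))"

(* The closed topological support. *)
definition measure_supp :: "real measure \<Rightarrow> real set" where
  "measure_supp M = {x. \<forall>U. open U \<and> x \<in> U \<longrightarrow> emeasure M U > 0}"

(* Functions are not identified up to null sets. *)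
definition L2_space :: "real measure \<Rightarrow> (real \<Rightarrow> real) set" where
  "L2_space M = {g \<in> borel_measurable M. integrable M (\<lambda>x. (g x)\<^sup>2)}"

definition L2_converges :: "real measure \<Rightarrow> (nat \<Rightarrow> real \<Rightarrow> real) \<Rightarrow> (real \<Rightarrow> real) \<Rightarrow> bool" where
  "L2_converges M S g \<longleftrightarrow>
     (\<forall>n. S n \<in> L2_space M) \<and> g \<in> L2_space M \<and>
     (\<lambda>n. LINT x|M. (S n x - g x)\<^sup>2) \<longlonglongrightarrow> 0"

definition monic_poly :: "nat \<Rightarrow> real poly \<Rightarrow> bool" where
  "monic_poly n p \<longleftrightarrow> degree p = n \<and> coeff p n = 1"

definition monic_orthogonal :: "real measure \<Rightarrow> (nat \<Rightarrow> real poly) \<Rightarrow> (nat \<Rightarrow> real) \<Rightarrow> bool" where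
  "monic_orthogonal M p c \<longleftrightarrow>
     (\<forall>n. monic_poly n (p n)) \<and>
     (\<forall>n m. (LINT x|M. poly (p n) x * poly (p m) x) = (if n = m then c n else 0))"

end

theory Submission
  imports Defs
begin

text \<open>For every polynomial \<open>p\<close> one has \<open>\<integral>p d\<beta> = \<integral>p W d\<alpha> = lim \<integral>p S\<^sub>n d\<alpha>\<close>, where \<open>S\<^sub>n\<close> are the
  partial sums of \<open>W\<close>, since \<open>L\<^sub>2\<close> convergence is weak convergence. With \<open>p = a\<^sub>i\<close> this gives
  \<open>\<integral>a\<^sub>i d\<beta> = w\<^sub>i\<close>, and the relations between \<open>a\<close> and \<open>\<phi>\<close> say that the power series with
  coefficients \<open>f\<close> and \<open>w\<close> are mutually inverse. If \<open>W\<close> is a polynomial of degree at most \<open>N\<close>,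
  then \<open>\<integral>a\<^sub>n b\<^sub>m d\<beta> = \<integral>a\<^sub>n b\<^sub>m W d\<alpha>\<close> vanishes for \<open>m + N < n\<close>, so the expansion of \<open>a\<^sub>n\<close> in the \<open>b\<^sub>m\<close>
  has only the terms with \<open>m \<ge> n - N\<close>.\<close>

section \<open>Polynomials and weak convergence in \<open>L2_space\<close>\<close>

lemma integrable_poly:
  assumes "finite_moments M"
  shows "integrable M (poly p)"
proof -
  have "integrable M (\<lambda>x. \<Sum>i\<le>degree p. coeff p i * x ^ i)"
    using assms unfolding finite_moments_def by (intro Bochner_Integration.integrable_sum integrable_mult_right) auto
  then show ?thesis by (simp add: poly_altdef[abs_def])
qed

lemma integrable_poly_mult:
  assumes "finite_moments M"
  shows "integrable M (\<lambda>x. poly p x * poly q x)"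
  using integrable_poly[OF assms, of "p * q"] by (simp add: poly_mult[abs_def])

lemma poly_in_L2_space:
  assumes "finite_moments M"
  shows "poly p \<in> L2_space M"
  using integrable_poly[OF assms, of p] integrable_poly_mult[OF assms, of p p]
  by (auto simp: L2_space_def power2_eq_square)

lemma integrable_mult_L2:
  assumes "f \<in> L2_space M" "g \<in> L2_space M"
  shows "integrable M (\<lambda>x. f x * g x)"
proof (rule Bochner_Integration.integrable_bound)
  have [measurable]: "f \<in> borel_measurable M" "g \<in> borel_measurable M"
    using assms by (auto simp: L2_space_def)
  show "integrable M (\<lambda>x. (f x)\<^sup>2 + (g x)\<^sup>2)"
    using assms by (auto simp: L2_space_def)
  show "(\<lambda>x. f x * g x) \<in> borel_measurable M" by measurable
  have "\<bar>u * v\<bar> \<le> u\<^sup>2 + v\<^sup>2" for u v :: real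
    using sum_squares_bound[of "\<bar>u\<bar>" "\<bar>v\<bar>"] mult_nonneg_nonneg[of "\<bar>u\<bar>" "\<bar>v\<bar>"]
    unfolding abs_mult power2_abs by linarith
  then show "AE x in M. norm (f x * g x) \<le> norm ((f x)\<^sup>2 + (g x)\<^sup>2)" by auto
qed

lemma diff_in_L2_space:
  assumes "f \<in> L2_space M" "g \<in> L2_space M"
  shows "(\<lambda>x. f x - g x) \<in> L2_space M"
proof -
  have "integrable M (\<lambda>x. (f x)\<^sup>2 + (g x)\<^sup>2 - 2 * (f x * g x))"
    using assms integrable_mult_L2[OF assms] by (auto simp: L2_space_def)
  then show ?thesis
    using assms by (auto simp: L2_space_def power2_diff mult.assoc)
qed

text \<open>Expanding the nonnegative integral of \<open>(Q * g x - P * f x)\<^sup>2\<close> gives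
  \<open>Q * (Q * R - P\<^sup>2)\<close>, and a positive \<open>Q\<close> can be cancelled. If
  \<open>Q = 0\<close>, then \<open>f\<close> vanishes almost everywhere and so does the
  product.\<close>

lemma Cauchy_Schwarz_L2:
  assumes "f \<in> L2_space M" "g \<in> L2_space M"
  shows "(LINT x|M. f x * g x)\<^sup>2 \<le> (LINT x|M. (f x)\<^sup>2) * (LINT x|M. (g x)\<^sup>2)"
proof -
  define P where "P = (LINT x|M. f x * g x)"
  define Q where "Q = (LINT x|M. (f x)\<^sup>2)"
  define R where "R = (LINT x|M. (g x)\<^sup>2)"
  have f: "integrable M (\<lambda>x. (f x)\<^sup>2)" and g: "integrable M (\<lambda>x. (g x)\<^sup>2)"
    using assms by (auto simp: L2_space_def)
  note fg = integrable_mult_L2[OF assms]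
  have "0 \<le> (LINT x|M. (Q * g x - P * f x)\<^sup>2)" by simp
  also have "\<dots> = (LINT x|M. Q\<^sup>2 * (g x)\<^sup>2 - 2 * Q * P * (f x * g x) + P\<^sup>2 * (f x)\<^sup>2)"
    by (intro Bochner_Integration.integral_cong) (auto simp: power2_eq_square algebra_simps)
  also have "\<dots> = Q\<^sup>2 * R - 2 * Q * P * P + P\<^sup>2 * Q"
    using f g fg by (simp add: P_def Q_def R_def)
  also have "\<dots> = Q * (Q * R - P\<^sup>2)"
    by (simp add: power2_eq_square algebra_simps)
  finally have *: "0 \<le> Q * (Q * R - P\<^sup>2)" .
  have "0 \<le> Q" by (simp add: Q_def)
  show ?thesis
  proof (cases "Q = 0")
    case True
    then have "AE x in M. (f x)\<^sup>2 = 0"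
      using integral_nonneg_eq_0_iff_AE[OF f] by (simp add: Q_def)
    then have "AE x in M. f x * g x = 0" by (auto elim: eventually_mono)
    then have "P = 0" unfolding P_def by (rule integral_eq_zero_AE)
    then show ?thesis using True by (simp add: P_def Q_def)
  next
    case False
    with \<open>0 \<le> Q\<close> have "0 < Q" by simp
    with * have "P\<^sup>2 \<le> Q * R" by (simp add: zero_le_mult_iff)
    then show ?thesis by (simp add: P_def Q_def R_def)
  qed
qed

text \<open>By Cauchy-Schwarz, the squared difference of the two integrals is at most the integral
  of \<open>(h x)\<^sup>2\<close> times the squared distance from \<open>S n\<close> to
  \<open>g\<close>.\<close>

lemma L2_converges_integral_mult:
  assumes S: "L2_converges M S g" and h: "h \<in> L2_space M"
  shows "(\<lambda>n. LINT x|M. h x * S n x) \<longlonglongrightarrow> (LINT x|M. h x * g x)"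
proof -
  have Sn: "\<And>n. S n \<in> L2_space M" and g: "g \<in> L2_space M"
    and lim: "(\<lambda>n. LINT x|M. (S n x - g x)\<^sup>2) \<longlonglongrightarrow> 0"
    using S by (auto simp: L2_converges_def)
  have "(\<lambda>n. (LINT x|M. (h x)\<^sup>2) * (LINT x|M. (S n x - g x)\<^sup>2)) \<longlonglongrightarrow> (LINT x|M. (h x)\<^sup>2) * 0"
    by (intro tendsto_mult tendsto_const lim)
  then have *: "(\<lambda>n. (LINT x|M. (h x)\<^sup>2) * (LINT x|M. (S n x - g x)\<^sup>2)) \<longlonglongrightarrow> 0" by simp
  have "(\<lambda>n. (LINT x|M. h x * (S n x - g x))\<^sup>2) \<longlonglongrightarrow> 0"
    by (rule tendsto_sandwich[OF _ _ tendsto_const *])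
      (auto intro!: always_eventually Cauchy_Schwarz_L2[OF h diff_in_L2_space[OF Sn g]])
  then have "(\<lambda>n. LINT x|M. h x * (S n x - g x)) \<longlonglongrightarrow> 0" by simp
  moreover have "(LINT x|M. h x * (S n x - g x)) = (LINT x|M. h x * S n x) - (LINT x|M. h x * g x)" for n
    using integrable_mult_L2[OF h Sn] integrable_mult_L2[OF h g] by (simp add: right_diff_distrib)
  ultimately show ?thesis by (simp add: LIM_zero_iff)
qed

text \<open>If the integral were zero, the density would vanish almost everywhere off the finite
  root set of \<open>p\<close>, which is Lebesgue null, and \<open>M\<close> could not have mass 1.
  This makes the squared norms of orthogonal polynomials legitimate divisors.\<close>

lemma integral_poly_square_pos:
  assumes "prob_space M" "finite_moments M" "has_lebesgue_density M D" "p \<noteq> 0"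
  shows "0 < (LINT x|M. (poly p x)\<^sup>2)"
proof (rule ccontr)
  have D: "M = density lborel (\<lambda>x. ennreal (D x))" "(\<lambda>x. ennreal (D x)) \<in> borel_measurable lborel"
    using assms(3) by (auto simp: has_lebesgue_density_def)
  assume "\<not> 0 < (LINT x|M. (poly p x)\<^sup>2)"
  moreover have "0 \<le> (LINT x|M. (poly p x)\<^sup>2)" by simp
  ultimately have "(LINT x|M. (poly p x)\<^sup>2) = 0" by linarith
  moreover have "integrable M (\<lambda>x. (poly p x)\<^sup>2)"
    using poly_in_L2_space[OF assms(2)] by (simp add: L2_space_def)
  ultimately have "AE x in M. (poly p x)\<^sup>2 = 0"
    using integral_nonneg_eq_0_iff_AE[of M "\<lambda>x. (poly p x)\<^sup>2"] by simp
  then have "AE x in lborel. 0 < D x \<longrightarrow> poly p x = 0"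
    unfolding D(1) using AE_density[OF D(2)] by simp
  moreover have "AE x in lborel. poly p x \<noteq> 0"
    using AE_not_in[OF finite_imp_null_set_lborel[OF poly_roots_finite[OF assms(4)]]] by simp
  ultimately have "AE x in lborel. \<not> 0 < D x"
    by eventually_elim auto
  then have "AE x in M. False"
    unfolding D(1) using AE_density[OF D(2)] by simp
  then show False
    using prob_space.AE_False[OF assms(1)] by simp
qed

section \<open>Expansions in monic orthogonal polynomials\<close>

lemma monic_poly_nonzero: "monic_poly n p \<Longrightarrow> p \<noteq> 0"
  by (auto simp: monic_poly_def)

lemma monic_poly_0_iff: "monic_poly 0 p \<longleftrightarrow> p = 1"
  by (auto simp: monic_poly_def one_pCons elim: degree_eq_zeroE)

lemma degree_diff_monic_poly:
  assumes "monic_poly n p" "monic_poly n q" "0 < n"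
  shows "degree (p - q) < n"
  using assms by (intro degree_lessI) (auto simp: monic_poly_def coeff_eq_0 not_less le_less)

text \<open>Subtracting the top coefficient times \<open>p (Suc n)\<close> lowers the degree bound
  by one, so induction on the bound applies.\<close>

lemma monic_basis_expansion:
  assumes "\<And>n. monic_poly n (p n)" "degree q \<le> n"
  shows "\<exists>d. q = (\<Sum>i\<le>n. smult (d i) (p i))"
  using assms(2)
proof (induction n arbitrary: q)
  case 0
  then have "q = [:coeff q 0:]" by (auto elim: degree_eq_zeroE)
  moreover have "p 0 = 1" using assms(1)[of 0] by (simp add: monic_poly_0_iff)
  ultimately have "q = (\<Sum>i\<le>0. smult (coeff q 0) (p i))" by simp
  then show ?case by (rule exI[of _ "\<lambda>_. coeff q 0"])
next
  case (Suc n)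
  let ?r = "q - smult (coeff q (Suc n)) (p (Suc n))"
  have p: "degree (p (Suc n)) = Suc n" "coeff (p (Suc n)) (Suc n) = 1"
    using assms(1)[of "Suc n"] by (auto simp: monic_poly_def)
  have "degree ?r \<le> n"
  proof (rule degree_le, intro allI impI)
    fix i assume "n < i"
    then consider "i = Suc n" | "Suc n < i" by linarith
    then show "coeff ?r i = 0"
      using p Suc.prems by cases (auto simp: coeff_eq_0)
  qed
  then obtain d where d: "?r = (\<Sum>i\<le>n. smult (d i) (p i))"
    using Suc.IH by blast
  have "q = ?r + smult (coeff q (Suc n)) (p (Suc n))" by simp
  also have "\<dots> = (\<Sum>i\<le>Suc n. smult ((d(Suc n := coeff q (Suc n))) i) (p i))"
    unfolding d by simp
  finally show ?case by blast
qed

lemma integral_sum_monic_orthogonal: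
  assumes M: "finite_moments M" and p: "monic_orthogonal M p c" and "finite I"
  shows "(LINT x|M. poly (\<Sum>i\<in>I. smult (d i) (p i)) x * poly (p m) x) = (if m \<in> I then d m * c m else 0)"
proof -
  have "(LINT x|M. poly (\<Sum>i\<in>I. smult (d i) (p i)) x * poly (p m) x) =
      (LINT x|M. (\<Sum>i\<in>I. d i * (poly (p i) x * poly (p m) x)))"
    by (simp add: poly_sum sum_distrib_right mult.assoc)
  also have "\<dots> = (\<Sum>i\<in>I. d i * (LINT x|M. poly (p i) x * poly (p m) x))"
    using integrable_poly_mult[OF M] by simp
  also have "\<dots> = (\<Sum>i\<in>I. if i = m then d i * c i else 0)"
    using p by (intro sum.cong) (auto simp: monic_orthogonal_def)
  finally show ?thesis using \<open>finite I\<close> by (auto simp: sum.delta)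
qed

text \<open>The polynomial \<open>q\<close> is a combination of \<open>p 0\<close> up to
  \<open>p (degree q)\<close>, and \<open>n\<close> is not among these indices.\<close>

lemma monic_orthogonal_lower_degree:
  assumes M: "finite_moments M" and p: "monic_orthogonal M p c" and "degree q < n"
  shows "(LINT x|M. poly q x * poly (p n) x) = 0"
proof -
  obtain d where "q = (\<Sum>i\<le>degree q. smult (d i) (p i))"
    using monic_basis_expansion[of p q "degree q"] p by (auto simp: monic_orthogonal_def)
  then show ?thesis
    using integral_sum_monic_orthogonal[OF M p, of "{..degree q}" d n] \<open>degree q < n\<close> by simp
qed

text \<open>Some expansion exists by degree; pairing it with \<open>p i\<close> isolates the
  coefficient times \<open>c i\<close>, so the coefficients must be these Fourier
  coefficients.\<close>

lemma monic_orthogonal_expansion: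
  assumes M: "finite_moments M" and p: "monic_orthogonal M p c" and c: "\<And>n. c n \<noteq> 0"
    and "degree q \<le> n"
  shows "q = (\<Sum>i\<le>n. smult ((LINT x|M. poly q x * poly (p i) x) / c i) (p i))"
proof -
  obtain d where d: "q = (\<Sum>i\<le>n. smult (d i) (p i))"
    using monic_basis_expansion[of p q n] p \<open>degree q \<le> n\<close> by (auto simp: monic_orthogonal_def)
  have "(LINT x|M. poly q x * poly (p i) x) = d i * c i" if "i \<le> n" for i
    unfolding d using integral_sum_monic_orthogonal[OF M p, of "{..n}" d i] that by simp
  then show ?thesis
    using c by (subst d) (auto intro!: sum.cong)
qed

text \<open>In terms of formal power series, \<open>fw\<close> says that \<open>f\<close> and
  \<open>w\<close> are inverse to each other and \<phi> is the product of \<open>a\<close> and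
  \<open>f\<close>; multiplying by \<open>w\<close> recovers \<open>a\<close>.\<close>

lemma convolution_inverse:
  fixes f w a \<phi> :: "nat \<Rightarrow> 'a::comm_ring_1"
  assumes fw: "\<And>n. (\<Sum>i=0..n. f (n - i) * w i) = (if n = 0 then 1 else 0)"
    and \<phi>: "\<And>n. \<phi> n = (\<Sum>i=0..n. f (n - i) * a i)"
  shows "a n = (\<Sum>i=0..n. w (n - i) * \<phi> i)"
proof -
  have 1: "Abs_fps w * Abs_fps f = 1"
    by (rule fps_ext) (simp add: fps_mult_nth fw mult.commute[of "w _"])
  have 2: "Abs_fps \<phi> = Abs_fps a * Abs_fps f"
    by (rule fps_ext) (simp add: fps_mult_nth \<phi> mult.commute[of "a _"])
  have "Abs_fps \<phi> * Abs_fps w = Abs_fps a"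
    using 1 by (simp add: 2 mult.assoc mult.commute[of "Abs_fps f"])
  then have "fps_nth (Abs_fps a) n = fps_nth (Abs_fps \<phi> * Abs_fps w) n" by simp
  then show ?thesis by (simp add: fps_mult_nth mult.commute[of "\<phi> _"])
qed

text \<open>The quotient condition says nothing where \<open>A = 0\<close>; that \<open>\<beta>\<close> has no mass there is
  forced by \<open>\<integral>W d\<alpha> = 1\<close>.\<close>
lemma density_eq_of_quotient:
  assumes "prob_space \<beta>"
    and A: "has_lebesgue_density \<alpha> A" and B: "has_lebesgue_density \<beta> B"
    and W: "integrable \<alpha> W" "(LINT x|\<alpha>. W x) = 1"
    and quot: "AE x in \<alpha>. B x / A x = W x"
  shows "AE x in lborel. B x = A x * W x"
proof -
  have [measurable]: "A \<in> borel_measurable borel" "B \<in> borel_measurable borel"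
    and A0: "\<And>x. 0 \<le> A x" and B0: "\<And>x. 0 \<le> B x"
    and \<alpha>: "\<alpha> = density lborel (\<lambda>x. ennreal (A x))"
    and \<beta>: "\<beta> = density lborel (\<lambda>x. ennreal (B x))"
    using A B by (auto simp: has_lebesgue_density_def)
  have [measurable]: "W \<in> borel_measurable borel"
    using borel_measurable_integrable[OF W(1)] by (simp add: \<alpha>)
  have AE: "AE x in lborel. 0 < A x \<longrightarrow> B x / A x = W x"
    using quot unfolding \<alpha> by (subst (asm) AE_density) auto
  have AW: "integrable lborel (\<lambda>x. A x * W x)" "(LINT x|lborel. A x * W x) = 1"
    using W A0 by (auto simp: \<alpha> integrable_real_density integral_real_density)
  interpret prob_space \<beta> by fact
  have "integrable \<beta> (\<lambda>x. 1::real)" by simp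
  then have B1: "integrable lborel B" "(LINT x|lborel. B x) = 1"
    using integrable_real_density[of B lborel "\<lambda>_. 1"] integral_real_density[of B lborel "\<lambda>_. 1"]
      B0 prob_space by (simp_all add: \<beta>)
  have "(LINT x|lborel. B x - A x * W x) = 0" using AW B1 by simp
  \<comment> \<open>Where \<open>A x > 0\<close> the quotient condition makes the difference zero;
    where \<open>A x = 0\<close> it equals \<open>B x\<close>. A nonnegative function with integral
    \<open>1 - 1 = 0\<close> vanishes almost everywhere.\<close>
  moreover have "AE x in lborel. 0 \<le> B x - A x * W x"
    using AE
  proof eventually_elim
    case (elim x)
    then show ?case using A0[of x] B0[of x] by (cases "A x = 0") (auto simp: field_simps)
  qed
  ultimately have "AE x in lborel. B x - A x * W x = 0"
    using integral_nonneg_eq_0_iff_AE[of lborel "\<lambda>x. B x - A x * W x"] AW B1 by simp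
  then show ?thesis by simp
qed

theorem proposition1:
  fixes \<alpha> \<beta> :: "real measure"
    and A B W :: "real \<Rightarrow> real"
    and a b \<phi> :: "nat \<Rightarrow> real poly"
    and ahat bhat w f :: "nat \<Rightarrow> real"
    and N :: enat
  assumes "prob_space \<alpha>" and "prob_space \<beta>"
    and "finite_moments \<alpha>" and "finite_moments \<beta>"
    and "has_lebesgue_density \<alpha> A" and "has_lebesgue_density \<beta> B"
    and "measure_supp \<beta> \<subseteq> measure_supp \<alpha>"
    and "monic_orthogonal \<alpha> a ahat" and "monic_orthogonal \<beta> b bhat"
    and "\<And>i. ahat i = (LINT x|lborel. (poly (a i) x)\<^sup>2 * A x)"
    and "N \<ge> 1"
    and "L2_converges \<alpha>
           (\<lambda>n x. 1 + (\<Sum>i\<in>{i\<in>{1..n}. enat i \<le> N}. w i * (poly (a i) x / ahat i))) W"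
    and "AE x in \<alpha>. B x / A x = W x"
    and "w 0 = 1"
    and "\<And>i. N < enat i \<Longrightarrow> w i = 0"
    and "f 0 = 1"
    and "\<And>n. n \<ge> 1 \<Longrightarrow> (\<Sum>i=0..n. f (n - i) * w i) = 0"
    and "\<And>n. \<phi> n = (\<Sum>i=0..n. smult (f (n - i)) (a i))"
  shows
    "((\<forall>n. monic_poly n (\<phi> n)) \<and>
      (\<forall>n\<ge>1. has_bochner_integral lborel (\<lambda>x. poly (\<phi> n) x * B x) 0) \<and>
      (\<forall>n\<ge>1. a n = (\<Sum>i=0..n. smult (w (n - i)) (\<phi> i)))) \<and>
     (\<forall>K. N = enat K \<longrightarrow>
      (\<forall>i\<in>{1..K}. has_bochner_integral lborel (\<lambda>x. poly (a i) x * B x) (w i)) \<and>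
      (\<forall>i\<ge>K+1. has_bochner_integral lborel (\<lambda>x. poly (a i) x * B x) 0) \<and>
      (\<forall>n\<ge>K+1. a n = \<phi> n + (\<Sum>i=1..K. smult (w i) (\<phi> (n - i))))) \<and>
     (\<forall>K. N = enat K \<longrightarrow>
      (\<exists>\<gamma> :: nat \<Rightarrow> nat \<Rightarrow> real. \<forall>n\<ge>1.
        a n = b n + (\<Sum>j=1..K. smult (\<gamma> n j) (if j \<le> n then b (n - j) else 0))))"
proof -
  note \<alpha>_mom = assms(3) and \<beta>_mom = assms(4)
  note orth_a = assms(8) and orth_b = assms(9)
  note B_dens = assms(6)
  have monic_a: "monic_poly n (a n)" and monic_b: "monic_poly n (b n)" for n
    using orth_a orth_b by (auto simp: monic_orthogonal_def)
  have ahat_sq: "ahat n = (LINT x|\<alpha>. (poly (a n) x)\<^sup>2)" and bhat_sq: "bhat n = (LINT x|\<beta>. (poly (b n) x)\<^sup>2)" for n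
    using orth_a orth_b by (simp_all add: monic_orthogonal_def power2_eq_square)
  have ahat: "ahat n \<noteq> 0" and bhat: "bhat n \<noteq> 0" for n
    using integral_poly_square_pos[OF assms(1,3,5) monic_poly_nonzero[OF monic_a]]
      integral_poly_square_pos[OF assms(2,4,6) monic_poly_nonzero[OF monic_b]]
    by (simp_all add: ahat_sq bhat_sq less_imp_neq[THEN not_sym])
  have a0: "a 0 = 1" using monic_a[of 0] by (simp add: monic_poly_0_iff)
  interpret \<alpha>: prob_space \<alpha> by fact
  have ahat0: "ahat 0 = 1" by (simp add: ahat_sq a0 \<alpha>.prob_space)

  \<comment> \<open>Integrals of polynomials against the series for \<open>W\<close>\<close>
  define I where "I n = {i \<in> {0..n}. enat i \<le> N}" for n
  define S where "S n = (\<Sum>i\<in>I n. smult (w i / ahat i) (a i))" for n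
  \<comment> \<open>Index 0 lies in every \<open>I n\<close> and contributes
    \<open>w 0 / ahat 0 * a 0 = 1\<close>, the constant term of the series. Each partial sum thus
    becomes a single orthogonal expansion.\<close>
  have "poly (S n) x = 1 + (\<Sum>i\<in>{i\<in>{1..n}. enat i \<le> N}. w i * (poly (a i) x / ahat i))" for n x
  proof -
    have "I n = insert 0 {i\<in>{1..n}. enat i \<le> N}"
      by (auto simp: I_def zero_enat_def[symmetric])
    then show ?thesis
      using \<open>w 0 = 1\<close> by (simp add: S_def poly_sum a0 ahat0)
  qed
  then have "(\<lambda>n. poly (S n)) =
      (\<lambda>n x. 1 + (\<Sum>i\<in>{i\<in>{1..n}. enat i \<le> N}. w i * (poly (a i) x / ahat i)))"
    by (intro ext)
  with assms(12) have S: "L2_converges \<alpha> (\<lambda>n. poly (S n)) W" by metis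
  have W: "W \<in> L2_space \<alpha>" using S by (simp add: L2_converges_def)
  have lim_W: "(\<lambda>n. LINT x|\<alpha>. poly p x * poly (S n) x) \<longlonglongrightarrow> (LINT x|\<alpha>. poly p x * W x)" for p
    by (rule L2_converges_integral_mult[OF S poly_in_L2_space[OF \<alpha>_mom]])
  have int_W: "(LINT x|\<alpha>. poly (a i) x * W x) = w i" for i
  proof (rule LIMSEQ_unique[OF lim_W])
    \<comment> \<open>The sequence is constant from \<open>n = i\<close> on: orthogonality leaves
      \<open>w i / ahat i * ahat i\<close> if \<open>i\<close> is in \<open>I n\<close>, and for
      \<open>i\<close> beyond \<open>N\<close> both sides are 0.\<close>
    have "(LINT x|\<alpha>. poly (a i) x * poly (S n) x) = w i" if "i \<le> n" for n
      using integral_sum_monic_orthogonal[OF \<alpha>_mom orth_a, of "I n" "\<lambda>i. w i / ahat i" i] ahat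
        assms(15)[of i] that
      by (auto simp: S_def I_def mult.commute[of "poly (a i) _"] not_le)
    then show "(\<lambda>n. LINT x|\<alpha>. poly (a i) x * poly (S n) x) \<longlonglongrightarrow> w i"
      by (intro tendsto_eventually eventually_sequentiallyI[of i])
  qed
  \<comment> \<open>The case \<open>i = 0\<close> of \<open>int_W\<close> supplies the normalisation
    of \<open>W\<close> to total integral 1.\<close>
  have dens: "AE x in lborel. B x = A x * W x"
    using density_eq_of_quotient[OF assms(2,5,6) _ _ assms(13)]
      integrable_mult_L2[OF poly_in_L2_space[OF \<alpha>_mom] W, of 1] int_W[of 0] a0 \<open>w 0 = 1\<close> by simp
  have [measurable]: "A \<in> borel_measurable borel" "B \<in> borel_measurable borel" "W \<in> borel_measurable borel"
    and A0: "\<And>x. 0 \<le> A x" and B0: "\<And>x. 0 \<le> B x"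
    and \<alpha>: "\<alpha> = density lborel (\<lambda>x. ennreal (A x))"
    and \<beta>: "\<beta> = density lborel (\<lambda>x. ennreal (B x))"
    using assms(5,6) W by (auto simp: has_lebesgue_density_def L2_space_def)
  have meas_poly [measurable]: "poly p \<in> borel_measurable borel" for p :: "real poly"
    by (intro borel_measurable_continuous_onI continuous_intros)
  have \<beta>_eq: "has_bochner_integral lborel (\<lambda>x. poly p x * B x) (LINT x|\<beta>. poly p x)" for p
    using integrable_poly[OF \<beta>_mom, of p] B0
    by (simp add: has_bochner_integral_iff \<beta> integrable_real_density integral_real_density mult.commute)
  have \<beta>_W: "(LINT x|\<beta>. poly p x) = (LINT x|\<alpha>. poly p x * W x)" for p
  proof -
    have "(LINT x|\<beta>. poly p x) = (LINT x|lborel. B x * poly p x)"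
      using B0 by (simp add: \<beta> integral_real_density)
    also have "\<dots> = (LINT x|lborel. A x * (poly p x * W x))"
      using dens by (intro integral_cong_AE) (auto elim: eventually_mono)
    also have "\<dots> = (LINT x|\<alpha>. poly p x * W x)"
      using A0 by (simp add: \<alpha> integral_real_density)
    finally show ?thesis .
  qed
  have int_a: "has_bochner_integral lborel (\<lambda>x. poly (a i) x * B x) (w i)" for i
    using \<beta>_eq[of "a i"] by (simp add: \<beta>_W int_W)

  \<comment> \<open>The polynomials \<phi> and their inversion\<close>
  have fw: "(\<Sum>i=0..n. f (n - i) * w i) = (if n = 0 then 1 else 0)" for n
    using assms(14,16,17) by (cases "n = 0") auto
  have monic_\<phi>: "monic_poly n (\<phi> n)" for n
  proof -
    have a: "degree (a i) = i" "coeff (a i) i = 1" for i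
      using monic_a[of i] by (auto simp: monic_poly_def)
    have deg: "degree (\<phi> n) \<le> n"
      unfolding assms(18) using a by (intro degree_sum_le) (auto intro: order.trans[OF degree_smult_le])
    have "coeff (\<phi> n) n = (\<Sum>i=0..n. if i = n then 1 else 0)"
      unfolding assms(18) coeff_sum
      using a \<open>f 0 = 1\<close> by (intro sum.cong) (auto simp: coeff_eq_0)
    then have "coeff (\<phi> n) n = 1" by simp
    moreover from this deg have "degree (\<phi> n) = n"
      by (intro antisym le_degree) auto
    ultimately show ?thesis by (simp add: monic_poly_def)
  qed
  have int_\<phi>: "has_bochner_integral lborel (\<lambda>x. poly (\<phi> n) x * B x) 0" if "1 \<le> n" for n
  proof -
    \<comment> \<open>Since \<open>a i\<close> integrates to \<open>w i\<close>, the integral of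
      \<open>\<phi> n\<close> is exactly the convolution that the recursion for \<open>f\<close>
      sets to 0.\<close>
    have "has_bochner_integral lborel (\<lambda>x. \<Sum>i=0..n. f (n - i) * (poly (a i) x * B x))
        (\<Sum>i=0..n. f (n - i) * w i)"
      by (intro has_bochner_integral_sum has_bochner_integral_mult_right int_a)
    then show ?thesis
      using that by (simp add: fw assms(18) poly_sum sum_distrib_right mult.assoc)
  qed
  have a_\<phi>: "a n = (\<Sum>i=0..n. smult (w (n - i)) (\<phi> i))" for n
  proof -
    \<comment> \<open>The scalars are embedded as constant polynomials, so that \<open>f\<close>,
      \<open>w\<close>, \<open>a\<close> and \<phi> all lie in one commutative ring.\<close>
    have "(\<Sum>i=0..n. [:f (n - i):] * [:w i:]) = (if n = 0 then 1 else 0)" for n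
    proof -
      have "(\<Sum>i=0..n. [:f (n - i):] * [:w i:]) = [:\<Sum>i=0..n. f (n - i) * w i:]"
        by (rule poly_eqI) (simp add: coeff_sum coeff_pCons mult.commute split: nat.split)
      also have "\<dots> = (if n = 0 then 1 else 0)" unfolding fw by simp
      finally show ?thesis .
    qed
    from convolution_inverse[of "\<lambda>n. [:f n:]" "\<lambda>n. [:w n:]", OF this, of \<phi> a n] show ?thesis
      by (simp add: assms(18))
  qed
  have a_\<phi>_finite: "a n = \<phi> n + (\<Sum>i=1..K. smult (w i) (\<phi> (n - i)))" if "N = enat K" "K + 1 \<le> n" for K n
  proof -
    have "a n = (\<Sum>i=0..n. smult (w i) (\<phi> (n - i)))"
      unfolding a_\<phi>[of n] by (rule sum.reindex_bij_witness[of _ "\<lambda>i. n - i" "\<lambda>i. n - i"]) auto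
    also have "\<dots> = (\<Sum>i=0..K. smult (w i) (\<phi> (n - i)))"
      using that assms(15) by (intro sum.mono_neutral_right) auto
    also have "\<dots> = \<phi> n + (\<Sum>i=1..K. smult (w i) (\<phi> (n - i)))"
      using \<open>w 0 = 1\<close> sum.atLeast_Suc_atMost[of 0 K "\<lambda>i. smult (w i) (\<phi> (n - i))"] by simp
    finally show ?thesis .
  qed

  \<comment> \<open>Finite \<open>N\<close>: expansion of \<open>a n\<close> in the polynomials
    \<open>b\<close>\<close>
  have int_ab: "(LINT x|\<beta>. poly (a n) x * poly (b m) x) = 0" if N: "N = enat K" and "m + K < n" for K m n
  proof -
    have "I k = {0..K}" if "K \<le> k" for k
      using that by (auto simp: I_def N)
    \<comment> \<open>The partial sums are stationary from \<open>K\<close> on, so the limit in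
      \<open>lim_W\<close> is an integral against the polynomial \<open>S K\<close>; then
      \<open>b m * S K\<close> has degree below \<open>n\<close> and is orthogonal to
      \<open>a n\<close>.\<close>
    then have SK: "S k = S K" if "K \<le> k" for k
      using that by (simp add: S_def)
    have "degree (S K) \<le> K"
      unfolding S_def using monic_a
      by (intro degree_sum_le) (auto simp: I_def monic_poly_def intro: order.trans[OF degree_smult_le])
    then have "degree (b m * S K) < n"
      using monic_b[of m] \<open>m + K < n\<close> degree_mult_le[of "b m" "S K"] by (simp add: monic_poly_def)
    then have "(LINT x|\<alpha>. poly (b m * S K) x * poly (a n) x) = 0"
      by (rule monic_orthogonal_lower_degree[OF \<alpha>_mom orth_a])
    then have "(LINT x|\<alpha>. poly (a n * b m) x * poly (S k) x) = 0" if "K \<le> k" for k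
      using SK[OF that] by (simp add: mult_ac)
    then have "(\<lambda>k. LINT x|\<alpha>. poly (a n * b m) x * poly (S k) x) \<longlonglongrightarrow> 0"
      by (intro tendsto_eventually eventually_sequentiallyI[of K])
    then have "(LINT x|\<alpha>. poly (a n * b m) x * W x) = 0"
      by (rule LIMSEQ_unique[OF lim_W])
    then show ?thesis using \<beta>_W[of "a n * b m"] by simp
  qed
  \<comment> \<open>These are the Fourier coefficients of \<open>a n - b n\<close>, whose degree is
    below \<open>n\<close> because the leading terms cancel; this splits off \<open>b n\<close> with
    coefficient 1.\<close>
  define c where "c n m = (LINT x|\<beta>. poly (a n - b n) x * poly (b m) x) / bhat m" for n m
  have c0: "c n m = 0" if N: "N = enat K" and "m + K < n" for K m n
  proof -
    have "(LINT x|\<beta>. poly (b n) x * poly (b m) x) = 0"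
      using orth_b \<open>m + K < n\<close> by (auto simp: monic_orthogonal_def)
    then show ?thesis
      using int_ab[OF that] integrable_poly_mult[OF \<beta>_mom] by (simp add: c_def left_diff_distrib)
  qed
  have a_b: "a n = b n + (\<Sum>j=1..K. smult (if j \<le> n then c n (n - j) else 0) (if j \<le> n then b (n - j) else 0))"
    if N: "N = enat K" and n: "1 \<le> n" for K n
  proof -
    have "degree (a n - b n) \<le> n - 1"
      using degree_diff_monic_poly[OF monic_a monic_b, of n] n by simp
    then have "a n - b n = (\<Sum>m\<le>n - 1. smult (c n m) (b m))"
      unfolding c_def by (rule monic_orthogonal_expansion[OF \<beta>_mom orth_b bhat])
    also have "\<dots> = (\<Sum>j\<in>{1..n}. smult (c n (n - j)) (b (n - j)))"
      using n by (intro sum.reindex_bij_witness[of _ "\<lambda>j. n - j" "\<lambda>j. n - j"]) auto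
    \<comment> \<open>For \<open>K < j \<le> n\<close> the index \<open>n - j\<close> satisfies
      \<open>n - j + K < n\<close>, so \<open>c0\<close> removes the term.\<close>
    also have "\<dots> = (\<Sum>j\<in>{1..n} \<inter> {1..K}. smult (c n (n - j)) (b (n - j)))"
      using c0[OF N] by (intro sum.mono_neutral_right) auto
    \<comment> \<open>For \<open>j > n\<close> truncated subtraction would turn
      \<open>b (n - j)\<close> into \<open>b 0\<close>. The guard implements the convention that
      \<open>b\<close> is zero at negative indices, and the coefficient is set to 0 there as
      well.\<close>
    also have "\<dots> = (\<Sum>j=1..K. smult (if j \<le> n then c n (n - j) else 0) (if j \<le> n then b (n - j) else 0))"
      by (rule sum.mono_neutral_cong_left) auto
    finally show ?thesis by (simp add: algebra_simps)
  qed
  show ?thesis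
  proof (intro conjI allI impI ballI)
    fix K i assume "N = enat K" "K + 1 \<le> i"
    then show "has_bochner_integral lborel (\<lambda>x. poly (a i) x * B x) 0"
      using int_a[of i] assms(15)[of i] by simp
  next
    fix K assume N: "N = enat K"
    show "\<exists>\<gamma>. \<forall>n\<ge>1. a n = b n + (\<Sum>j=1..K. smult (\<gamma> n j) (if j \<le> n then b (n - j) else 0))"
      by (rule exI[of _ "\<lambda>n j. if j \<le> n then c n (n - j) else 0"]) (use a_b[OF N] in blast)
  qed (rule monic_\<phi> int_\<phi> a_\<phi> int_a a_\<phi>_finite; assumption)+
qed

end
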